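(* The rotationally symmetric map $\varphi:(S^2,dr^2+\sin^2r\,d\theta^2)\longrightarrow(S^2,d\rho^2+\sin^2\rho\,d\phi^2)$ with $\varphi(r,\theta)=(r,-\sqrt3\,\theta)$ is a proper $f$-biharmonic map for $$f(r,\theta)=\left|\frac{(\tan\frac r2)^{1-\sqrt3}\left(\tan^2\frac r2+7-4\sqrt3\right)\left(\tan^2\frac r2-2+\sqrt3\right)}{\left(1+\tan^2\frac r2\right)^2\left(\tan^2\frac r2-1\right)}\right| ,$$ which is smooth on $(0,\pi)$ except at $r=\frac\pi2$ and $r=2\arctan\sqrt{2-\sqrt3}$.
   Context: For a smooth map $\phi:(M,g)\to(N,h)$ of Riemannian manifolds, $\tau(\phi)=\mathrm{Tr}_g\nabla d\phi$ is the tension field and $\tau_2(\phi)=\mathrm{Trace}_g(\nabla^\phi\nabla^\phi-\nabla^\phi_{\nabla^M})\tau(\phi)-\mathrm{Trace}_g R^N(d\phi,\tau(\phi))d\phi$ is the bitension field, with $R^N(X,Y)Z=[\nabla^N_X,\nabla^N_Y]Z-\nabla^N_{[X,Y]}Z$. The map is harmonic if $\tau(\phi)=0$ and biharmonic if $\tau_2(\phi)=0$. For a positive function $f$ on $M$, it is $f$-biharmonic if $f\tau_2(\phi)+(\Delta f)\tau(\phi)+2\nabla^\phi_{\mathrm{grad} f}\tau(\phi)=0$, and proper $f$-biharmonic if it is $f$-biharmonic but neither harmonic nor biharmonic. On the standard 2-sphere, $(r,\theta)$ (resp. $(\rho,\phi)$ on the target) are geodesic polar coordinates, with $0<r<\pi$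 and $\theta$ the angular coordinate. As an $f$-biharmonic map, the map is allowed to have singular points. *)

theory Defs
  imports "HOL-Analysis.Analysis"
begin

section \<open>Smoothness on open subsets of a normed space\<close>

text \<open>
  Both notions are meant for open \<open>S\<close>.  \<open>Ck_on k F S\<close> requires all iterated directional
  derivatives up to order \<open>k\<close>, so on a finite-dimensional domain it is the usual \<open>C\<^sup>k\<close>.
\<close>

primrec Ck_on :: "nat \<Rightarrow> ('a::real_normed_vector \<Rightarrow> 'b::real_normed_vector) \<Rightarrow> 'a set \<Rightarrow> bool" where
  "Ck_on 0 F S \<longleftrightarrow> continuous_on S F"
| "Ck_on (Suc k) F S \<longleftrightarrow>
     (\<forall>x\<in>S. F differentiable (at x)) \<and>
     (\<forall>v. Ck_on k (\<lambda>x. frechet_derivative F (at x) v) S)"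

definition smooth_on :: "'a::real_normed_vector set \<Rightarrow> ('a \<Rightarrow> 'b::real_normed_vector) \<Rightarrow> bool" where
  "smooth_on S F \<longleftrightarrow> (\<forall>k. Ck_on k F S)"

definition smooth_at :: "('a::real_normed_vector \<Rightarrow> 'b::real_normed_vector) \<Rightarrow> 'a \<Rightarrow> bool" where
  "smooth_at F x \<longleftrightarrow> (\<exists>S. open S \<and> x \<in> S \<and> smooth_on S F)"


section \<open>Riemannian geometry in a coordinate chart\<close>

text \<open>
  A chart of a Riemannian manifold is an open \<open>U\<close> in \<open>real ^ 'n\<close> with the matrix-valued function
  \<open>g\<close> of metric coefficients.  Tangent vectors are vectors of components with respect to the
  coordinate frame; vector fields, and sections of a pull-back bundle along a map, are
  vector-valued functions on the chart.  The coordinate frame field \<open>\<partial>\<^sub>i\<close> is the constant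
  field \<open>axis i 1\<close>.
\<close>

definition riemannian_metric_on :: "(real ^ 'n) set \<Rightarrow> (real ^ 'n \<Rightarrow> real ^ 'n ^ 'n) \<Rightarrow> bool" where
  "riemannian_metric_on U g \<longleftrightarrow>
     open U \<and> smooth_on U g \<and>
     (\<forall>x\<in>U. transpose (g x) = g x \<and> (\<forall>v. v \<noteq> 0 \<longrightarrow> v \<bullet> (g x *v v) > 0))"

abbreviation inv_metric :: "(real ^ 'n \<Rightarrow> real ^ 'n ^ 'n) \<Rightarrow> real ^ 'n \<Rightarrow> 'n \<Rightarrow> 'n \<Rightarrow> real" where
  "inv_metric g x i j \<equiv> matrix_inv (g x) $ i $ j"

definition metric_trace ::
  "(real ^ 'n \<Rightarrow> real ^ 'n ^ 'n) \<Rightarrow> real ^ 'n \<Rightarrow>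
   (real ^ 'n \<Rightarrow> real ^ 'n \<Rightarrow> 'b::real_vector) \<Rightarrow> 'b" where
  "metric_trace g x B =
     (\<Sum>i\<in>UNIV. \<Sum>j\<in>UNIV. inv_metric g x i j *\<^sub>R B (axis i 1) (axis j 1))"

definition partial :: "'n \<Rightarrow> (real ^ 'n \<Rightarrow> 'b::real_normed_vector) \<Rightarrow> real ^ 'n \<Rightarrow> 'b" where
  "partial i F x = frechet_derivative F (at x) (axis i 1)"

definition christoffel ::
  "(real ^ 'n \<Rightarrow> real ^ 'n ^ 'n) \<Rightarrow> real ^ 'n \<Rightarrow> 'n \<Rightarrow> 'n \<Rightarrow> 'n \<Rightarrow> real" where
  "christoffel g x k i j =
     (1/2) * (\<Sum>l\<in>UNIV. inv_metric g x k l *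
       (partial i (\<lambda>y. g y $ j $ l) x + partial j (\<lambda>y. g y $ i $ l) x
         - partial l (\<lambda>y. g y $ i $ j) x))"

definition christoffel_form ::
  "(real ^ 'n \<Rightarrow> real ^ 'n ^ 'n) \<Rightarrow> real ^ 'n \<Rightarrow> real ^ 'n \<Rightarrow> real ^ 'n \<Rightarrow> real ^ 'n" where
  "christoffel_form g x u v =
     (\<chi> k. \<Sum>i\<in>UNIV. \<Sum>j\<in>UNIV. christoffel g x k i j * (u $ i) * (v $ j))"

text \<open>The Levi-Civita connection, \<open>\<nabla>\<^sub>X Y\<close>.\<close>

definition levi_civita ::
  "(real ^ 'n \<Rightarrow> real ^ 'n ^ 'n) \<Rightarrow> (real ^ 'n \<Rightarrow> real ^ 'n) \<Rightarrow> (real ^ 'n \<Rightarrow> real ^ 'n) \<Rightarrow>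
   real ^ 'n \<Rightarrow> real ^ 'n" where
  "levi_civita g X Y x = frechet_derivative Y (at x) (X x) + christoffel_form g x (X x) (Y x)"

definition lie_bracket ::
  "(real ^ 'n \<Rightarrow> real ^ 'n) \<Rightarrow> (real ^ 'n \<Rightarrow> real ^ 'n) \<Rightarrow> real ^ 'n \<Rightarrow> real ^ 'n" where
  "lie_bracket X Y x = frechet_derivative Y (at x) (X x) - frechet_derivative X (at x) (Y x)"

definition curvature ::
  "(real ^ 'n \<Rightarrow> real ^ 'n ^ 'n) \<Rightarrow> (real ^ 'n \<Rightarrow> real ^ 'n) \<Rightarrow> (real ^ 'n \<Rightarrow> real ^ 'n) \<Rightarrow>
   (real ^ 'n \<Rightarrow> real ^ 'n) \<Rightarrow> real ^ 'n \<Rightarrow> real ^ 'n" where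
  "curvature g X Y Z x =
     levi_civita g X (levi_civita g Y Z) x - levi_civita g Y (levi_civita g X Z) x
     - levi_civita g (lie_bracket X Y) Z x"

text \<open>
  The curvature is tensorial, so on tangent vectors at \<open>x\<close> it may be evaluated on any extensions
  to vector fields; constant-coefficient ones are used.
\<close>

definition curvature_at ::
  "(real ^ 'n \<Rightarrow> real ^ 'n ^ 'n) \<Rightarrow> real ^ 'n \<Rightarrow> real ^ 'n \<Rightarrow> real ^ 'n \<Rightarrow> real ^ 'n \<Rightarrow> real ^ 'n" where
  "curvature_at g x u v w = curvature g (\<lambda>_. u) (\<lambda>_. v) (\<lambda>_. w) x"

definition gradient :: "(real ^ 'n \<Rightarrow> real ^ 'n ^ 'n) \<Rightarrow> (real ^ 'n \<Rightarrow> real) \<Rightarrow> real ^ 'n \<Rightarrow> real ^ 'n" where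
  "gradient g f x = (\<chi> i. \<Sum>j\<in>UNIV. inv_metric g x i j * partial j f x)"

text \<open>Sign convention: \<open>\<Delta> f\<close> is the trace of the Hessian of \<open>f\<close>.\<close>

definition laplacian :: "(real ^ 'n \<Rightarrow> real ^ 'n ^ 'n) \<Rightarrow> (real ^ 'n \<Rightarrow> real) \<Rightarrow> real ^ 'n \<Rightarrow> real" where
  "laplacian g f x =
     metric_trace g x (\<lambda>u v.
       frechet_derivative (\<lambda>y. frechet_derivative f (at y) v) (at x) u
       - frechet_derivative f (at x) (levi_civita g (\<lambda>_. u) (\<lambda>_. v) x))"


section \<open>Harmonic, biharmonic and f-biharmonic maps\<close>

abbreviation push :: "(real ^ 'm \<Rightarrow> real ^ 'n) \<Rightarrow> (real ^ 'm \<Rightarrow> real ^ 'm) \<Rightarrow> real ^ 'm \<Rightarrow> real ^ 'n" where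
  "push \<phi> X x \<equiv> frechet_derivative \<phi> (at x) (X x)"

text \<open>
  The pull-back connection \<open>\<nabla>\<^sup>\<phi>\<^sub>X W\<close> on sections \<open>W\<close> along \<open>\<phi>\<close>;
  \<open>h\<close> is the target metric.
\<close>

definition pullback_conn ::
  "(real ^ 'n \<Rightarrow> real ^ 'n ^ 'n) \<Rightarrow> (real ^ 'm \<Rightarrow> real ^ 'n) \<Rightarrow>
   (real ^ 'm \<Rightarrow> real ^ 'm) \<Rightarrow> (real ^ 'm \<Rightarrow> real ^ 'n) \<Rightarrow> real ^ 'm \<Rightarrow> real ^ 'n" where
  "pullback_conn h \<phi> X W x =
     frechet_derivative W (at x) (X x) + christoffel_form h (\<phi> x) (push \<phi> X x) (W x)"

definition tension ::
  "(real ^ 'm \<Rightarrow> real ^ 'm ^ 'm) \<Rightarrow> (real ^ 'n \<Rightarrow> real ^ 'n ^ 'n) \<Rightarrow>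
   (real ^ 'm \<Rightarrow> real ^ 'n) \<Rightarrow> real ^ 'm \<Rightarrow> real ^ 'n" where
  "tension g h \<phi> x =
     metric_trace g x (\<lambda>u v.
       pullback_conn h \<phi> (\<lambda>_. u) (push \<phi> (\<lambda>_. v)) x
       - push \<phi> (levi_civita g (\<lambda>_. u) (\<lambda>_. v)) x)"

definition bitension ::
  "(real ^ 'm \<Rightarrow> real ^ 'm ^ 'm) \<Rightarrow> (real ^ 'n \<Rightarrow> real ^ 'n ^ 'n) \<Rightarrow>
   (real ^ 'm \<Rightarrow> real ^ 'n) \<Rightarrow> real ^ 'm \<Rightarrow> real ^ 'n" where
  "bitension g h \<phi> x =
     metric_trace g x (\<lambda>u v.
       pullback_conn h \<phi> (\<lambda>_. u) (pullback_conn h \<phi> (\<lambda>_. v) (tension g h \<phi>)) x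
       - pullback_conn h \<phi> (levi_civita g (\<lambda>_. u) (\<lambda>_. v)) (tension g h \<phi>) x)
     - metric_trace g x (\<lambda>u v.
         curvature_at h (\<phi> x) (push \<phi> (\<lambda>_. u) x) (tension g h \<phi> x) (push \<phi> (\<lambda>_. v) x))"

definition riemannian_smooth_map ::
  "(real ^ 'm) set \<Rightarrow> (real ^ 'm \<Rightarrow> real ^ 'm ^ 'm) \<Rightarrow>
   (real ^ 'n) set \<Rightarrow> (real ^ 'n \<Rightarrow> real ^ 'n ^ 'n) \<Rightarrow> (real ^ 'm \<Rightarrow> real ^ 'n) \<Rightarrow> bool" where
  "riemannian_smooth_map U g V h \<phi> \<longleftrightarrow>
     riemannian_metric_on U g \<and> riemannian_metric_on V h \<and> smooth_on U \<phi> \<and> \<phi> ` U \<subseteq> V"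

definition harmonic_map ::
  "(real ^ 'm) set \<Rightarrow> (real ^ 'm \<Rightarrow> real ^ 'm ^ 'm) \<Rightarrow> (real ^ 'n \<Rightarrow> real ^ 'n ^ 'n) \<Rightarrow>
   (real ^ 'm \<Rightarrow> real ^ 'n) \<Rightarrow> bool" where
  "harmonic_map U g h \<phi> \<longleftrightarrow> (\<forall>x\<in>U. tension g h \<phi> x = 0)"

definition biharmonic_map ::
  "(real ^ 'm) set \<Rightarrow> (real ^ 'm \<Rightarrow> real ^ 'm ^ 'm) \<Rightarrow> (real ^ 'n \<Rightarrow> real ^ 'n ^ 'n) \<Rightarrow>
   (real ^ 'm \<Rightarrow> real ^ 'n) \<Rightarrow> bool" where
  "biharmonic_map U g h \<phi> \<longleftrightarrow> (\<forall>x\<in>U. bitension g h \<phi> x = 0)"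

definition f_biharmonic_map ::
  "(real ^ 'm) set \<Rightarrow> (real ^ 'm \<Rightarrow> real ^ 'm ^ 'm) \<Rightarrow>
   (real ^ 'n) set \<Rightarrow> (real ^ 'n \<Rightarrow> real ^ 'n ^ 'n) \<Rightarrow>
   (real ^ 'm \<Rightarrow> real) \<Rightarrow> (real ^ 'm \<Rightarrow> real ^ 'n) \<Rightarrow> bool" where
  "f_biharmonic_map U g V h f \<phi> \<longleftrightarrow>
     riemannian_smooth_map U g V h \<phi> \<and>
     smooth_on U f \<and> (\<forall>x\<in>U. f x > 0) \<and>
     (\<forall>x\<in>U. f x *\<^sub>R bitension g h \<phi> x
            + laplacian g f x *\<^sub>R tension g h \<phi> x
            + 2 *\<^sub>R pullback_conn h \<phi> (gradient g f) (tension g h \<phi>) x = 0)"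

definition proper_f_biharmonic_map ::
  "(real ^ 'm) set \<Rightarrow> (real ^ 'm \<Rightarrow> real ^ 'm ^ 'm) \<Rightarrow>
   (real ^ 'n) set \<Rightarrow> (real ^ 'n \<Rightarrow> real ^ 'n ^ 'n) \<Rightarrow>
   (real ^ 'm \<Rightarrow> real) \<Rightarrow> (real ^ 'm \<Rightarrow> real ^ 'n) \<Rightarrow> bool" where
  "proper_f_biharmonic_map U g V h f \<phi> \<longleftrightarrow>
     f_biharmonic_map U g V h f \<phi> \<and> \<not> harmonic_map U g h \<phi> \<and> \<not> biharmonic_map U g h \<phi>"


section \<open>The 2-sphere in geodesic polar coordinates\<close>

text \<open>
  Component \<open>1\<close> is the distance \<open>r\<close> from the pole and component \<open>2\<close> the angular coordinate
  \<open>\<theta>\<close>.  The angle ranges over all reals: a map \<open>(r, \<theta>) \<mapsto> (r, k \<theta>)\<close>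
  with \<open>k\<close> not an integer does not descend to the twice punctured sphere itself, only to the
  pieces where a branch of the angle has been chosen.  Every such piece is covered by restricting
  \<open>\<theta>\<close> to an interval of length at most \<open>2 * pi\<close>.
\<close>

definition polar_chart :: "(real ^ 2) set" where
  "polar_chart = {x. 0 < x $ 1 \<and> x $ 1 < pi}"

definition sphere_metric :: "real ^ 2 \<Rightarrow> real ^ 2 ^ 2" where
  "sphere_metric x = vector [vector [1, 0], vector [0, (sin (x $ 1))\<^sup>2]]"

text \<open>
  The metric \<open>dr\<^sup>2 + sin\<^sup>2 r d\<theta>\<^sup>2\<close> is the one induced from Euclidean space by the polar
  parametrization of the unit sphere.
\<close>

definition sphere_param :: "real ^ 2 \<Rightarrow> real ^ 3" where
  "sphere_param x =
     vector [sin (x $ 1) * cos (x $ 2), sin (x $ 1) * sin (x $ 2), cos (x $ 1)]"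

lemma sphere_param_in_sphere: "sphere_param x \<in> sphere 0 1"
proof -
  have "(norm (sphere_param x))\<^sup>2
      = (sin (x $ 1) * cos (x $ 2))\<^sup>2 + (sin (x $ 1) * sin (x $ 2))\<^sup>2 + (cos (x $ 1))\<^sup>2"
    unfolding power2_norm_eq_inner sphere_param_def inner_vec_def sum_3
    by (simp add: power2_eq_square)
  also have "\<dots> = 1"
    using sin_cos_squared_add[of "x $ 1"] sin_cos_squared_add[of "x $ 2"] by algebra
  finally show ?thesis
    by (simp add: norm_eq_1 power2_norm_eq_inner)
qed

lemma sphere_metric_induced:
  "frechet_derivative sphere_param (at x) u \<bullet> frechet_derivative sphere_param (at x) v
     = u \<bullet> (sphere_metric x *v v)"
proof -
  define D :: "real ^ 2 \<Rightarrow> real ^ 3" where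
    "D = (\<lambda>w. vector [cos (x $ 1) * cos (x $ 2) * w $ 1 - sin (x $ 1) * sin (x $ 2) * w $ 2,
                      cos (x $ 1) * sin (x $ 2) * w $ 1 + sin (x $ 1) * cos (x $ 2) * w $ 2,
                      - sin (x $ 1) * w $ 1])"
  have "(sphere_param has_derivative D) (at x)"
    unfolding has_derivative_componentwise_within[where f = sphere_param]
  proof
    fix b :: "real ^ 3" assume "b \<in> Basis"
    then obtain i where b: "b = axis i 1" by (auto simp: Basis_vec_def)
    have nth: "((\<lambda>y::real^2. y $ j) has_derivative (\<lambda>w. w $ j)) (at x)" for j
      by (rule bounded_linear_imp_has_derivative) (rule bounded_linear_vec_nth)
    consider "i = 1" | "i = 2" | "i = 3" using exhaust_3 by blast
    then show "((\<lambda>y. sphere_param y \<bullet> b) has_derivative (\<lambda>w. D w \<bullet> b)) (at x)"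
      by cases (auto simp: b inner_axis sphere_param_def D_def algebra_simps
          intro!: derivative_eq_intros nth)
  qed
  then have "frechet_derivative sphere_param (at x) = D"
    by (rule frechet_derivative_at[symmetric])
  moreover have "D u \<bullet> D v = u \<bullet> (sphere_metric x *v v)"
  proof -
    have c: "(cos t)\<^sup>2 = 1 - (sin t)\<^sup>2" for t :: real
      by (simp add: cos_squared_eq)
    show ?thesis
      unfolding D_def sphere_metric_def inner_vec_def sum_3 sum_2 matrix_vector_mult_def
      using c[of "x $ 1"] c[of "x $ 2"]
      by simp algebra
  qed
  ultimately show ?thesis by simp
qed

end

theory Submission
  imports Defs
begin

text \<open>
  For a map \<open>(r, \<theta>) \<mapsto> (r, k \<theta>)\<close> of the round sphere everything depends on \<open>r\<close> alone.  The
  tension field is \<open>(1 - k\<^sup>2) cot r \<partial>\<^sub>\<rho>\<close>, the bitension field is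
  \<open>(1 - k\<^sup>2) (cos r / sin\<^sup>3 r) (1 - k\<^sup>2 + 2 k\<^sup>2 sin\<^sup>2 r) \<partial>\<^sub>\<rho>\<close> (lemmas \<open>tension_eq\<close> and
  \<open>bitension_eq\<close>), and for a weight \<open>F(r)\<close> the \<open>f\<close>-biharmonic equation has only a radial component,
  which is a linear ordinary differential equation of second order for \<open>F\<close>
  (\<open>f_biharmonic_operator\<close>).  For \<open>k = - sqrt 3\<close> neither field vanishes identically, so the map is
  neither harmonic nor biharmonic, and it remains to see that the given weight solves the equation.

  Without the absolute value, the weight is a constant multiple of
  \<open>tan(r/2) powr (- sqrt 3) * sin r * (1 - sqrt 3 * cos r) * (2 - sqrt 3 * cos r) / cos r\<close>
  (\<open>weight_formula\<close>).  In this form it is easy to differentiate, because \<open>ln (tan (r / 2))\<close> has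
  derivative \<open>1 / sin r\<close>, and the differential equation becomes a polynomial identity
  (\<open>weight_ode\<close>).  The equation is linear, so it also holds for the absolute value wherever the
  weight is finite and nonzero, since the sign is locally constant there.

  The weight has a simple zero where \<open>cos r = 1 / sqrt 3\<close>, that is at
  \<open>r = 2 arctan (sqrt (2 - sqrt 3))\<close>, and a pole at \<open>r = pi / 2\<close>; it has no other zero or pole in the
  open interval.  At the simple zero the absolute value has a kink (\<open>DERIV_abs_at_zero\<close>), and at the
  pole no value makes it continuous.  Elsewhere it is a composition of elementary functions, hence
  smooth; as smoothness asks for derivatives of all orders, this is shown for a class of functions
  that is closed under differentiation (\<open>elementary_on\<close>, \<open>smooth_on_radial\<close>).
\<close>

section \<open>Smooth functions of one coordinate\<close>

text \<open>
  A coinduction principle: if every member of a class \<open>P\<close> is differentiable with all its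
  directional derivatives in \<open>P\<close> again, then derivatives can be taken forever.  Letting \<open>F\<close> agree
  with a member of \<open>P\<close> only on the open set \<open>S\<close> is what makes the induction on the order go
  through, as a derivative is known on \<open>S\<close> only.
\<close>

lemma smooth_on_coinduct:
  assumes S: "open S" and F: "P F\<^sub>0" "\<And>x. x \<in> S \<Longrightarrow> F x = F\<^sub>0 x"
    and diff: "\<And>G x. P G \<Longrightarrow> x \<in> S \<Longrightarrow> G differentiable (at x)"
    and deriv: "\<And>G v. P G \<Longrightarrow> \<exists>H. P H \<and> (\<forall>x\<in>S. frechet_derivative G (at x) v = H x)"
  shows "smooth_on S F"
proof -
  have "Ck_on k H S" if "P G" "\<And>x. x \<in> S \<Longrightarrow> H x = G x" for k G H
    using that
  proof (induction k arbitrary: G H)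
    case 0
    have "continuous_on S G"
      using diff[OF 0(1)] by (meson continuous_at_imp_continuous_on differentiable_imp_continuous_within)
    then show ?case
      using 0(2) by (simp cong: continuous_on_cong)
  next
    case (Suc k)
    have fd: "frechet_derivative G (at x) = frechet_derivative H (at x)" if "x \<in> S" for x
      by (rule frechet_derivative_transform_within_open[OF diff[OF Suc.prems(1) that] S that])
        (simp add: Suc.prems(2))
    have "H differentiable (at x)" if "x \<in> S" for x
    proof -
      obtain D where "(G has_derivative D) (at x)"
        using diff[OF Suc.prems(1) \<open>x \<in> S\<close>] unfolding differentiable_def by blast
      then have "(H has_derivative D) (at x)"
        by (rule has_derivative_transform_within_open[OF _ S that]) (simp add: Suc.prems(2))
      then show ?thesis by (auto simp: differentiable_def)
    qed
    moreover have "Ck_on k (\<lambda>x. frechet_derivative H (at x) v) S" for v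
    proof -
      obtain G' where G': "P G'" "\<forall>x\<in>S. frechet_derivative G (at x) v = G' x"
        using deriv[OF Suc.prems(1)] by blast
      show ?thesis
        by (rule Suc.IH[OF G'(1)]) (use G'(2) fd in auto)
    qed
    ultimately show ?case by simp
  qed
  then show ?thesis
    unfolding smooth_on_def using F by blast
qed

lemma smooth_at_imp_differentiable:
  assumes "smooth_at F x"
  shows "F differentiable (at x)"
proof -
  obtain S where "x \<in> S" "Ck_on 1 F S"
    using assms unfolding smooth_at_def smooth_on_def by blast
  then show ?thesis by simp
qed

text \<open>
  The class is closed under differentiation, so that membership, a purely syntactic matter, gives
  smoothness.  Constants enter as functions with derivative \<open>0\<close> on \<open>I\<close>; this also admits locally
  constant functions such as the sign of a function without zeros in \<open>I\<close>, which is how absolute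
  values are treated.
\<close>

inductive elementary_on :: "real set \<Rightarrow> (real \<Rightarrow> real) \<Rightarrow> bool" for I where
  locally_constant: "(\<And>r. r \<in> I \<Longrightarrow> (u has_real_derivative 0) (at r)) \<Longrightarrow> elementary_on I u"
| ident: "elementary_on I (\<lambda>r. r)"
| sin: "elementary_on I u \<Longrightarrow> elementary_on I (\<lambda>r. sin (u r))"
| cos: "elementary_on I u \<Longrightarrow> elementary_on I (\<lambda>r. cos (u r))"
| exp: "elementary_on I u \<Longrightarrow> elementary_on I (\<lambda>r. exp (u r))"
| ln: "elementary_on I u \<Longrightarrow> (\<And>r. r \<in> I \<Longrightarrow> u r > 0) \<Longrightarrow> elementary_on I (\<lambda>r. ln (u r))"
| add: "elementary_on I u \<Longrightarrow> elementary_on I w \<Longrightarrow> elementary_on I (\<lambda>r. u r + w r)"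
| mult: "elementary_on I u \<Longrightarrow> elementary_on I w \<Longrightarrow> elementary_on I (\<lambda>r. u r * w r)"
| divide: "elementary_on I u \<Longrightarrow> elementary_on I w \<Longrightarrow> (\<And>r. r \<in> I \<Longrightarrow> w r \<noteq> 0) \<Longrightarrow>
    elementary_on I (\<lambda>r. u r / w r)"

lemma elementary_const: "elementary_on I (\<lambda>_. c)"
  by (rule elementary_on.locally_constant) simp

lemma elementary_diff:
  assumes "elementary_on I u" "elementary_on I w"
  shows "elementary_on I (\<lambda>r. u r - w r)"
  using elementary_on.add[OF assms(1) elementary_on.mult[OF elementary_const[of I "-1"] assms(2)]]
  by simp

lemmas elementary_intros = elementary_const elementary_diff elementary_on.ident elementary_on.sin
  elementary_on.cos elementary_on.exp elementary_on.ln elementary_on.add elementary_on.mult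
  elementary_on.divide

lemma elementary_on_has_derivative:
  assumes "elementary_on I u"
  shows "\<exists>u'. elementary_on I u' \<and> (\<forall>r\<in>I. (u has_real_derivative u' r) (at r))"
  using assms
proof induction
  case (locally_constant u)
  then show ?case using elementary_const[of I 0] by blast
next
  case ident
  show ?case using elementary_const[of I 1] by (intro exI[of _ "\<lambda>_. 1"]) simp
next
  case (sin u)
  then obtain u' where "elementary_on I u'" "\<forall>r\<in>I. (u has_real_derivative u' r) (at r)" by blast
  then show ?case using sin(1)
    by (intro exI[of _ "\<lambda>r. cos (u r) * u' r"])
      (auto intro!: elementary_intros derivative_eq_intros)
next
  case (cos u)
  then obtain u' where "elementary_on I u'" "\<forall>r\<in>I. (u has_real_derivative u' r) (at r)" by blast
  then show ?case using cos(1)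
    by (intro exI[of _ "\<lambda>r. 0 - sin (u r) * u' r"] conjI elementary_intros)
      (auto intro!: derivative_eq_intros)
next
  case (exp u)
  then obtain u' where "elementary_on I u'" "\<forall>r\<in>I. (u has_real_derivative u' r) (at r)" by blast
  then show ?case using exp(1)
    by (intro exI[of _ "\<lambda>r. exp (u r) * u' r"])
      (auto intro!: elementary_intros derivative_eq_intros)
next
  case (ln u)
  then obtain u' where "elementary_on I u'" "\<forall>r\<in>I. (u has_real_derivative u' r) (at r)" by blast
  moreover have "u r \<noteq> 0" if "r \<in> I" for r using ln(2)[OF that] by simp
  ultimately show ?case using ln(1,2)
    by (intro exI[of _ "\<lambda>r. u' r / u r"])
      (auto intro!: elementary_intros derivative_eq_intros simp: divide_simps)
next
  case (add u w)
  then obtain u' w' where "elementary_on I u'" "\<forall>r\<in>I. (u has_real_derivative u' r) (at r)"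
    "elementary_on I w'" "\<forall>r\<in>I. (w has_real_derivative w' r) (at r)" by blast
  then show ?case
    by (intro exI[of _ "\<lambda>r. u' r + w' r"])
      (auto intro!: elementary_intros derivative_eq_intros)
next
  case (mult u w)
  then obtain u' w' where "elementary_on I u'" "\<forall>r\<in>I. (u has_real_derivative u' r) (at r)"
    "elementary_on I w'" "\<forall>r\<in>I. (w has_real_derivative w' r) (at r)" by blast
  then show ?case using mult(1,2)
    by (intro exI[of _ "\<lambda>r. u' r * w r + w' r * u r"])
      (auto intro!: elementary_intros derivative_eq_intros)
next
  case (divide u w)
  then obtain u' w' where "elementary_on I u'" "\<forall>r\<in>I. (u has_real_derivative u' r) (at r)"
    "elementary_on I w'" "\<forall>r\<in>I. (w has_real_derivative w' r) (at r)" by blast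
  then show ?case using divide(1-3)
    by (intro exI[of _ "\<lambda>r. (u' r * w r - u r * w' r) / (w r * w r)"])
      (auto intro!: elementary_intros derivative_eq_intros)
qed

lemma has_derivative_nth1:
  fixes x :: "real ^ 'n"
  assumes "(u has_real_derivative d) (at (x $ i))"
  shows "((\<lambda>y. u (y $ i)) has_derivative (\<lambda>v. d * v $ i)) (at x)"
proof -
  have nth: "((\<lambda>y::real^'n. y $ i) has_derivative (\<lambda>w. w $ i)) (at x)"
    by (rule bounded_linear_imp_has_derivative) (rule bounded_linear_vec_nth)
  have "(u has_derivative (\<lambda>t. d * t)) (at (x $ i))"
    using assms by (simp add: has_field_derivative_def)
  from has_derivative_compose[OF nth this] show ?thesis .
qed

text \<open>
  The vectors \<open>C\<close> and \<open>E\<close> let the same argument serve real functions and matrix-valued ones.  The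
  class for the coinduction consists of all such expressions with \<open>E\<close> fixed: a derivative in
  direction \<open>v\<close> has the coefficient \<open>u' * v $ i\<close> in place of \<open>u\<close>, and \<open>0\<close> in place of \<open>C\<close>.
\<close>

lemma smooth_on_radial:
  fixes C E :: "'b::real_normed_vector" and S :: "(real ^ 'n) set"
  assumes S: "open S" and I: "\<And>y. y \<in> S \<Longrightarrow> y $ i \<in> I" and u: "elementary_on I u"
    and F: "\<And>y. y \<in> S \<Longrightarrow> F y = C + u (y $ i) *\<^sub>R E"
  shows "smooth_on S F"
proof -
  define P where "P = (\<lambda>F :: real ^ 'n \<Rightarrow> 'b. \<exists>C u. elementary_on I u \<and> F = (\<lambda>y. C + u (y $ i) *\<^sub>R E))"
  have D: "\<exists>u'. elementary_on I u' \<and>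
      (\<forall>x\<in>S. ((\<lambda>y. C + u (y $ i) *\<^sub>R E) has_derivative (\<lambda>v. (u' (x $ i) * v $ i) *\<^sub>R E)) (at x))"
    if u: "elementary_on I u" for C :: 'b and u
  proof -
    obtain u' where u': "elementary_on I u'" "\<forall>r\<in>I. (u has_real_derivative u' r) (at r)"
      using elementary_on_has_derivative[OF u] by blast
    have "((\<lambda>y. C + u (y $ i) *\<^sub>R E) has_derivative (\<lambda>v. (u' (x $ i) * v $ i) *\<^sub>R E)) (at x)"
      if "x \<in> S" for x
      using u'(2) I[OF that] by (auto intro!: derivative_eq_intros has_derivative_nth1)
    with u'(1) show ?thesis by blast
  qed
  show ?thesis
  proof (rule smooth_on_coinduct[where P = P, OF S _ F])
    show "P (\<lambda>y. C + u (y $ i) *\<^sub>R E)" using u unfolding P_def by blast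
  next
    fix G :: "real ^ 'n \<Rightarrow> 'b" and x assume "P G" "x \<in> S"
    then show "G differentiable (at x)"
      unfolding P_def using D by (auto simp: differentiable_def) blast
  next
    fix G :: "real ^ 'n \<Rightarrow> 'b" and v :: "real ^ 'n" assume "P G"
    then obtain C u where u: "elementary_on I u" and G: "G = (\<lambda>y. C + u (y $ i) *\<^sub>R E)"
      unfolding P_def by blast
    from D[OF u, of C] obtain u' where u': "elementary_on I u'"
      "\<And>x. x \<in> S \<Longrightarrow> (G has_derivative (\<lambda>v. (u' (x $ i) * v $ i) *\<^sub>R E)) (at x)"
      unfolding G by blast
    have "P (\<lambda>x. 0 + (u' (x $ i) * v $ i) *\<^sub>R E)"
      unfolding P_def using elementary_on.mult[OF u'(1) elementary_const[of I "v $ i"]]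
      by (intro exI[of _ 0] exI[of _ "\<lambda>r. u' r * v $ i"]) simp
    moreover have "\<forall>x\<in>S. frechet_derivative G (at x) v = 0 + (u' (x $ i) * v $ i) *\<^sub>R E"
      by (simp add: frechet_derivative_at[OF u'(2), symmetric])
    ultimately show "\<exists>H. P H \<and> (\<forall>x\<in>S. frechet_derivative G (at x) v = H x)" by blast
  qed
qed

lemma smooth_on_linear:
  assumes "bounded_linear F" and S: "open S"
  shows "smooth_on S F"
proof (rule smooth_on_coinduct[where P = "\<lambda>G. G = F \<or> (\<exists>c. G = (\<lambda>_. c))" and F\<^sub>0 = F, OF S])
  have F: "(F has_derivative F) (at x)" for x
    using assms(1) by (rule bounded_linear_imp_has_derivative)
  show "G differentiable (at x)" if "G = F \<or> (\<exists>c. G = (\<lambda>_. c))" for G x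
    using that F differentiableI[OF F] by auto
  show "\<exists>H. (H = F \<or> (\<exists>c. H = (\<lambda>_. c))) \<and> (\<forall>x\<in>S. frechet_derivative G (at x) v = H x)"
    if "G = F \<or> (\<exists>c. G = (\<lambda>_. c))" for G v
    using that frechet_derivative_at[OF F] by (intro exI[of _ "if G = F then (\<lambda>_. F v) else (\<lambda>_. 0)"]) auto
qed simp_all

section \<open>The round metric in polar coordinates\<close>

lemma polar_chart_sin_pos: "x \<in> polar_chart \<Longrightarrow> sin (x $ 1) > 0"
  by (auto simp: polar_chart_def sin_gt_zero)

lemma open_polar_chart: "open polar_chart"
proof -
  have "polar_chart = (\<lambda>x::real^2. x $ 1) -` {0<..<pi}"
    by (auto simp: polar_chart_def)
  then show ?thesis
    by (metis open_vimage_vec_nth open_greaterThanLessThan)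
qed

lemma sphere_metric_eq: 
  "sphere_metric x $ 1 $ 1 = 1" "sphere_metric x $ 1 $ 2 = 0"
  "sphere_metric x $ 2 $ 1 = 0" "sphere_metric x $ 2 $ 2 = (sin (x $ 1))\<^sup>2"
  by (simp_all add: sphere_metric_def)

lemma matrix_inv_eqI:
  fixes A :: "'a::semiring_1 ^ 'n ^ 'n"
  assumes "A ** B = mat 1" "B ** A = mat 1"
  shows "matrix_inv A = B"
proof -
  have "A ** matrix_inv A = mat 1 \<and> matrix_inv A ** A = mat 1"
    unfolding matrix_inv_def
    by (rule someI[of "\<lambda>A'. A ** A' = mat 1 \<and> A' ** A = mat 1" B]) (simp add: assms)
  then have "matrix_inv A ** (A ** B) = B"
    by (simp add: matrix_mul_assoc)
  then show ?thesis by (simp add: assms)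
qed

lemma inv_sphere_metric:
  assumes "x \<in> polar_chart"
  shows "matrix_inv (sphere_metric x) = vector [vector [1, 0], vector [0, 1 / (sin (x $ 1))\<^sup>2]]"
    (is "_ = ?B")
proof -
  have s: "sin (x $ 1) \<noteq> 0" using polar_chart_sin_pos[OF assms] by simp
  have "sphere_metric x ** ?B = mat 1" "?B ** sphere_metric x = mat 1"
    using s by (simp_all add: vec_eq_iff forall_2 matrix_matrix_mult_def sum_2 sphere_metric_def mat_def)
  then show ?thesis
    by (rule matrix_inv_eqI)
qed

lemma metric_trace_sphere:
  assumes "x \<in> polar_chart"
  shows "metric_trace sphere_metric x B
    = B (axis 1 1) (axis 1 1) + (1 / (sin (x $ 1))\<^sup>2) *\<^sub>R B (axis 2 1) (axis 2 1)"
  by (simp add: metric_trace_def sum_2 inv_sphere_metric[OF assms])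

lemma partial_sphere_metric:
  "partial i (\<lambda>y. sphere_metric y $ j $ l) x
     = (if i = 1 \<and> j = 2 \<and> l = 2 then 2 * sin (x $ 1) * cos (x $ 1) else 0)"
proof -
  have *: "((\<lambda>y::real^2. (sin (y $ 1))\<^sup>2) has_derivative (\<lambda>v. (2 * sin (x $ 1) * cos (x $ 1)) * v $ 1)) (at x)"
    by (rule has_derivative_nth1) (auto intro!: derivative_eq_intros)
  show ?thesis
    using exhaust_2[of i] exhaust_2[of j] exhaust_2[of l]
    by (elim disjE) (simp_all add: partial_def sphere_metric_eq frechet_derivative_at[OF *, symmetric] axis_def)
qed

lemma christoffel_form_sphere:
  assumes "x \<in> polar_chart"
  shows "christoffel_form sphere_metric x u v =
    vector [- sin (x $ 1) * cos (x $ 1) * u $ 2 * v $ 2,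
            cos (x $ 1) / sin (x $ 1) * (u $ 1 * v $ 2 + u $ 2 * v $ 1)]"
proof -
  have s: "sin (x $ 1) \<noteq> 0" using polar_chart_sin_pos[OF assms] by simp
  have G: "christoffel sphere_metric x k i j =
    (if k = 1 \<and> i = 2 \<and> j = 2 then - sin (x $ 1) * cos (x $ 1)
     else if k = 2 \<and> i \<noteq> j then cos (x $ 1) / sin (x $ 1) else 0)" for k i j
    using exhaust_2[of i] exhaust_2[of j] exhaust_2[of k] s
    by (elim disjE)
      (simp_all add: christoffel_def sum_2 partial_sphere_metric inv_sphere_metric[OF assms] power2_eq_square)
  show ?thesis
    by (simp add: vec_eq_iff forall_2 christoffel_form_def sum_2 G algebra_simps)
qed

lemma has_derivative_radial_vector:
  fixes x :: "real ^ 2"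
  assumes "(a has_real_derivative a') (at (x $ 1))" "(b has_real_derivative b') (at (x $ 1))"
  shows "((\<lambda>y. vector [a (y $ 1), b (y $ 1)] :: real ^ 2) has_derivative
           (\<lambda>v. vector [a' * v $ 1, b' * v $ 1])) (at x)"
  unfolding has_derivative_componentwise_within[where f = "\<lambda>y. vector [a (y $ 1), b (y $ 1)]"]
proof
  fix e :: "real ^ 2" assume "e \<in> Basis"
  then obtain i where e: "e = axis i 1" by (auto simp: Basis_vec_def)
  consider "i = 1" | "i = 2" using exhaust_2 by blast
  then show "((\<lambda>y. (vector [a (y $ 1), b (y $ 1)] :: real ^ 2) \<bullet> e) has_derivative
      (\<lambda>v. vector [a' * v $ 1, b' * v $ 1] \<bullet> e)) (at x)"
    by cases (simp_all add: e inner_axis has_derivative_nth1[OF assms(1)] has_derivative_nth1[OF assms(2)])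
qed

lemma frechet_derivative_radial_vector:
  fixes x :: "real ^ 2"
  assumes "x \<in> polar_chart" and W: "\<And>y. y \<in> polar_chart \<Longrightarrow> W y = vector [a (y $ 1), b (y $ 1)]"
    and ab: "(a has_real_derivative a') (at (x $ 1))" "(b has_real_derivative b') (at (x $ 1))"
  shows "frechet_derivative W (at x) v = (vector [a' * v $ 1, b' * v $ 1] :: real ^ 2)"
proof -
  have "(W has_derivative (\<lambda>v. vector [a' * v $ 1, b' * v $ 1])) (at x)"
    by (rule has_derivative_transform_within_open[OF has_derivative_radial_vector[OF ab]
        open_polar_chart assms(1)]) (simp add: W)
  from frechet_derivative_at[OF this] show ?thesis by (rule fun_cong[OF sym])
qed

lemma levi_civita_sphere_const:
  assumes "x \<in> polar_chart"
  shows "levi_civita sphere_metric (\<lambda>_. u) (\<lambda>_. v) x =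
    vector [- sin (x $ 1) * cos (x $ 1) * u $ 2 * v $ 2,
            cos (x $ 1) / sin (x $ 1) * (u $ 1 * v $ 2 + u $ 2 * v $ 1)]"
  by (simp add: levi_civita_def christoffel_form_sphere[OF assms])

lemma DERIV_cos_over_sin:
  assumes "sin r \<noteq> (0::real)"
  shows "((\<lambda>r. cos r / sin r) has_real_derivative - 1 / (sin r)\<^sup>2) (at r)"
  using DERIV_cot[OF assms] by (simp add: cot_def[abs_def] inverse_eq_divide)

text \<open>
  The unit sphere has constant curvature \<open>1\<close>.  The second covariant derivatives are computed in
  coordinates; the identity \<open>cos\<^sup>2 + sin\<^sup>2 = 1\<close> removes all denominators from them.
\<close>

lemma curvature_sphere:
  assumes x: "x \<in> polar_chart"
  shows "curvature_at sphere_metric x u v w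
    = (v \<bullet> (sphere_metric x *v w)) *\<^sub>R u - (u \<bullet> (sphere_metric x *v w)) *\<^sub>R v"
proof -
  define s c where "s = sin (x $ 1)" and "c = cos (x $ 1)"
  define q where "q = c / s"
  have s: "s \<noteq> 0" using polar_chart_sin_pos[OF x] by (simp add: s_def)
  have c: "c * c = 1 - s * s"
    using sin_cos_squared_add3[of "x $ 1"] unfolding s_def c_def by linarith
  have q: "q * s = c" using s by (simp add: q_def)
  \<comment> \<open>The derivative of the cotangent \<open>q\<close>, as a polynomial in \<open>q\<close>.\<close>
  have q2: "- 1 - q * q = - 1 / s\<^sup>2"
  proof -
    have "(- 1 - q * q) * s\<^sup>2 = - 1" using c q by algebra
    then show ?thesis using s by (subst eq_divide_eq) simp
  qed
  have second: "levi_civita sphere_metric (\<lambda>_. u) (levi_civita sphere_metric (\<lambda>_. v) (\<lambda>_. w)) x =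
      vector [(2 * s\<^sup>2 - 1) * v $ 2 * w $ 2 * u $ 1
                - (1 - s\<^sup>2) * u $ 2 * (v $ 1 * w $ 2 + v $ 2 * w $ 1),
              - u $ 1 * (v $ 1 * w $ 2 + v $ 2 * w $ 1) - (1 - s\<^sup>2) * u $ 2 * v $ 2 * w $ 2]"
    for u v w :: "real ^ 2"
  proof -
    let ?t = "v $ 1 * w $ 2 + v $ 2 * w $ 1"
    have a: "((\<lambda>r. - sin r * cos r * v $ 2 * w $ 2) has_real_derivative
        (s * s - c * c) * v $ 2 * w $ 2) (at (x $ 1))"
      by (auto intro!: derivative_eq_intros simp: algebra_simps s_def c_def)
    have b: "((\<lambda>r. cos r / sin r * ?t) has_real_derivative (- 1 - q * q) * ?t) (at (x $ 1))"
      unfolding q2 unfolding s_def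
      by (rule DERIV_cmult_right[OF DERIV_cos_over_sin]) (use s in \<open>simp add: s_def\<close>)
    have fd: "frechet_derivative (levi_civita sphere_metric (\<lambda>_. v) (\<lambda>_. w)) (at x) u =
        vector [((s * s - c * c) * v $ 2 * w $ 2) * u $ 1, ((- 1 - q * q) * ?t) * u $ 1]"
      by (rule frechet_derivative_radial_vector[OF x _ a b]) (rule levi_civita_sphere_const)
    show ?thesis
      unfolding levi_civita_def[of _ _ "levi_civita sphere_metric (\<lambda>_. v) (\<lambda>_. w)"] fd
        levi_civita_sphere_const[OF x] christoffel_form_sphere[OF x]
        s_def[symmetric] c_def[symmetric] q_def[symmetric]
      unfolding vec_eq_iff forall_2 vector_add_component vector_2
      using c q by (intro conjI; algebra)
  qed
  have b: "lie_bracket (\<lambda>_. u) (\<lambda>_. v) = (\<lambda>_. 0)"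
    by (simp add: lie_bracket_def fun_eq_iff)
  have z: "levi_civita sphere_metric (\<lambda>_. 0) (\<lambda>_. w) x = 0"
    by (simp add: levi_civita_sphere_const[OF x] vec_eq_iff forall_2)
  show ?thesis
    unfolding curvature_at_def curvature_def b z second
    by (simp add: vec_eq_iff forall_2 matrix_vector_mult_def inner_vec_def sum_2 sphere_metric_eq
        s_def[symmetric] algebra_simps)
qed

lemma riemannian_metric_sphere:
  assumes U: "open U" "U \<subseteq> polar_chart"
  shows "riemannian_metric_on U sphere_metric"
proof -
  have "smooth_on U sphere_metric"
  proof (rule smooth_on_radial[OF U(1), where i = 1])
    show "elementary_on {0<..<pi} (\<lambda>r. sin r * sin r)"
      by (intro elementary_intros)
    show "sphere_metric y = vector [vector [1, 0], vector [0, 0]]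
        + (sin (y $ 1) * sin (y $ 1)) *\<^sub>R vector [vector [0, 0], vector [0, 1]]" for y
      by (simp add: sphere_metric_def vec_eq_iff forall_2 power2_eq_square)
  qed (use U(2) in \<open>auto simp: polar_chart_def\<close>)
  moreover have "v \<bullet> (sphere_metric x *v v) > 0" if "x \<in> U" "v \<noteq> 0" for x v
  proof -
    have "v \<bullet> (sphere_metric x *v v) = (v $ 1)\<^sup>2 + (sin (x $ 1) * v $ 2)\<^sup>2"
      by (simp add: matrix_vector_mult_def inner_vec_def sum_2 sphere_metric_eq power2_eq_square)
    moreover have "v $ 1 \<noteq> 0 \<or> sin (x $ 1) * v $ 2 \<noteq> 0"
      using polar_chart_sin_pos[of x] U(2) that by (auto simp: vec_eq_iff forall_2)
    ultimately show ?thesis by (simp add: sum_power2_gt_zero_iff)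
  qed
  ultimately show ?thesis
    by (auto simp: riemannian_metric_on_def U(1) vec_eq_iff forall_2 transpose_def sphere_metric_eq)
qed

section \<open>The maps \<open>(r, \<theta>) \<mapsto> (r, k \<theta>)\<close>\<close>

text \<open>
  The derivative of such a map is the same linear map everywhere, and the metric depends on \<open>r\<close>
  alone, so that each covariant derivative reduces to derivatives of functions of one variable.
\<close>

locale angle_scaling =
  fixes k :: real and \<phi> :: "real ^ 2 \<Rightarrow> real ^ 2"
  assumes \<phi>: "\<phi> x = vector [x $ 1, k * x $ 2]"
begin

lemma map_polar_chart: "x \<in> polar_chart \<Longrightarrow> \<phi> x \<in> polar_chart"
  by (simp add: polar_chart_def \<phi>)

lemma bounded_linear_map: "bounded_linear \<phi>"
proof -
  have "linear \<phi>"
    by (rule linearI) (simp_all add: \<phi> vec_eq_iff forall_2 algebra_simps)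
  then show ?thesis by (rule linear_conv_bounded_linear[THEN iffD1])
qed

lemma push_eq: "frechet_derivative \<phi> (at x) u = vector [u $ 1, k * u $ 2]"
  by (simp add: frechet_derivative_at[OF bounded_linear_imp_has_derivative[OF bounded_linear_map],
        symmetric] \<phi>)

lemma pullback_conn_radial:
  assumes x: "x \<in> polar_chart"
    and W: "\<And>y. y \<in> polar_chart \<Longrightarrow> W y = vector [a (y $ 1), b (y $ 1)]"
    and ab: "(a has_real_derivative a') (at (x $ 1))" "(b has_real_derivative b') (at (x $ 1))"
  shows "pullback_conn sphere_metric \<phi> X W x = vector
    [a' * X x $ 1 - sin (x $ 1) * cos (x $ 1) * k * X x $ 2 * b (x $ 1),
     b' * X x $ 1 + cos (x $ 1) / sin (x $ 1) * (X x $ 1 * b (x $ 1) + k * X x $ 2 * a (x $ 1))]"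
proof -
  have "frechet_derivative W (at x) (X x) = vector [a' * X x $ 1, b' * X x $ 1]"
    by (rule frechet_derivative_radial_vector[OF x W ab])
  then show ?thesis
    unfolding pullback_conn_def push_eq christoffel_form_sphere[OF map_polar_chart[OF x]] W[OF x]
    by (simp add: \<phi> vec_eq_iff forall_2)
qed

lemma tension_eq:
  assumes x: "x \<in> polar_chart"
  shows "tension sphere_metric sphere_metric \<phi> x
    = vector [(1 - k\<^sup>2) * (cos (x $ 1) / sin (x $ 1)), 0]"
proof -
  have s: "sin (x $ 1) \<noteq> 0" using polar_chart_sin_pos[OF x] by simp
  have p: "pullback_conn sphere_metric \<phi> (\<lambda>_. u) (push \<phi> (\<lambda>_. v)) x = vector
    [- sin (x $ 1) * cos (x $ 1) * k * u $ 2 * (k * v $ 2),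
     cos (x $ 1) / sin (x $ 1) * (u $ 1 * (k * v $ 2) + k * u $ 2 * v $ 1)]" for u v
    by (subst pullback_conn_radial[OF x, where a = "\<lambda>_. v $ 1" and b = "\<lambda>_. k * v $ 2" and a' = 0 and b' = 0])
      (simp_all add: push_eq)
  show ?thesis
    unfolding tension_def metric_trace_sphere[OF x] p
    unfolding push_eq levi_civita_sphere_const[OF x]
    using s by (simp add: vec_eq_iff forall_2 axis_def power2_eq_square field_simps)
qed

lemma pullback_conn_tension:
  assumes x: "x \<in> polar_chart"
  shows "pullback_conn sphere_metric \<phi> X (tension sphere_metric sphere_metric \<phi>) x
    = (1 - k\<^sup>2) *\<^sub>R vector [- X x $ 1 / (sin (x $ 1))\<^sup>2, k * (cos (x $ 1) / sin (x $ 1))\<^sup>2 * X x $ 2]"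
proof -
  have s: "sin (x $ 1) \<noteq> 0" using polar_chart_sin_pos[OF x] by simp
  have a: "((\<lambda>r. (1 - k\<^sup>2) * (cos r / sin r)) has_real_derivative
      (1 - k\<^sup>2) * (- 1 / (sin (x $ 1))\<^sup>2)) (at (x $ 1))"
    by (rule DERIV_cmult[OF DERIV_cos_over_sin[OF s]])
  have b: "((\<lambda>r. 0) has_real_derivative 0) (at (x $ 1))" by simp
  have "pullback_conn sphere_metric \<phi> X (tension sphere_metric sphere_metric \<phi>) x
    = vector [(1 - k\<^sup>2) * (- 1 / (sin (x $ 1))\<^sup>2) * X x $ 1 - sin (x $ 1) * cos (x $ 1) * k * X x $ 2 * 0,
        0 * X x $ 1 + cos (x $ 1) / sin (x $ 1) *
          (X x $ 1 * 0 + k * X x $ 2 * ((1 - k\<^sup>2) * (cos (x $ 1) / sin (x $ 1))))]"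
    by (rule pullback_conn_radial[OF x _ a b]) (rule tension_eq)
  then show ?thesis
    by (simp add: vec_eq_iff forall_2 power2_eq_square)
qed

text \<open>
  For a section \<open>w(r) \<partial>\<^sub>\<rho>\<close> the rough Laplacian is
  \<open>w'' + cot r w' - k\<^sup>2 cot\<^sup>2 r w\<close> and the curvature term contributes \<open>k\<^sup>2 w\<close>; the formula is the
  value for \<open>w = (1 - k\<^sup>2) cot r\<close>.
\<close>

lemma bitension_eq:
  assumes x: "x \<in> polar_chart"
  shows "bitension sphere_metric sphere_metric \<phi> x
    = ((1 - k\<^sup>2) * (cos (x $ 1) / (sin (x $ 1)) ^ 3) * (1 - k\<^sup>2 + 2 * k\<^sup>2 * (sin (x $ 1))\<^sup>2)) *\<^sub>R axis 1 1"
proof -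
  define s c where "s = sin (x $ 1)" and "c = cos (x $ 1)"
  have s: "s \<noteq> 0" using polar_chart_sin_pos[OF x] by (simp add: s_def)
  have c: "c * c = 1 - s * s"
    using sin_cos_squared_add3[of "x $ 1"] unfolding s_def c_def by linarith
  let ?\<tau> = "tension sphere_metric sphere_metric \<phi>"
  have second: "pullback_conn sphere_metric \<phi> (\<lambda>_. u) (pullback_conn sphere_metric \<phi> (\<lambda>_. v) ?\<tau>) x
      = vector [(1 - k\<^sup>2) * (2 * c / s ^ 3 * v $ 1) * u $ 1 
            - s * c * k * u $ 2 * ((1 - k\<^sup>2) * (k * (c / s)\<^sup>2 * v $ 2)),
          (1 - k\<^sup>2) * (- 2 * k * c / s ^ 3 * v $ 2) * u $ 1 + c / s *
            (u $ 1 * ((1 - k\<^sup>2) * (k * (c / s)\<^sup>2 * v $ 2)) + k * u $ 2 * ((1 - k\<^sup>2) * (- v $ 1 / s\<^sup>2)))]"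
    for u v :: "real ^ 2"
  proof -
    have "((\<lambda>r. 1 / (sin r)\<^sup>2) has_real_derivative - 2 * c / s ^ 3) (at (x $ 1))"
      using s by (auto intro!: derivative_eq_intros simp: s_def c_def power2_eq_square power3_eq_cube field_simps)
    from DERIV_cmult[OF DERIV_cmult_right[OF DERIV_minus[OF this], of "v $ 1"], of "1 - k\<^sup>2"]
    have a: "((\<lambda>r. (1 - k\<^sup>2) * (- v $ 1 / (sin r)\<^sup>2)) has_real_derivative
        (1 - k\<^sup>2) * (2 * c / s ^ 3 * v $ 1)) (at (x $ 1))" by simp
    have "((\<lambda>r. (cos r / sin r)\<^sup>2) has_real_derivative - 2 * c / s ^ 3) (at (x $ 1))"
      using DERIV_power[OF DERIV_cos_over_sin, of "x $ 1" 2] s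
      by (simp add: s_def c_def power2_eq_square power3_eq_cube field_simps)
    from DERIV_cmult[OF DERIV_cmult_right[OF DERIV_cmult[OF this, of k], of "v $ 2"], of "1 - k\<^sup>2"]
    have b: "((\<lambda>r. (1 - k\<^sup>2) * (k * (cos r / sin r)\<^sup>2 * v $ 2)) has_real_derivative
        (1 - k\<^sup>2) * (- 2 * k * c / s ^ 3 * v $ 2)) (at (x $ 1))" 
      by (simp add: mult_ac)
    show ?thesis
      unfolding s_def c_def
      by (rule pullback_conn_radial[OF x _ a[unfolded s_def c_def] b[unfolded s_def c_def]])
        (simp add: pullback_conn_tension vec_eq_iff forall_2)
  qed
  \<comment> \<open>Naming the reciprocal of the sine turns the remaining identity into a polynomial one.\<close>
  define i where "i = 1 / s"
  have i: "i * s = 1" using s by (simp add: i_def)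
  have div: "y / s = y * i" "y / s\<^sup>2 = y * i * i" "y / s ^ 3 = y * i * i * i" for y
    by (simp_all add: i_def power2_eq_square power3_eq_cube)
  have axis: "axis 1 1 $ 1 = (1::real)" "axis 1 1 $ (2::2) = (0::real)" by (simp_all add: axis_def)
  have k2: "k\<^sup>2 = k * k" "i\<^sup>2 = i * i" "s\<^sup>2 = s * s" "(c * i)\<^sup>2 = c * i * (c * i)" by (simp_all add: power2_eq_square)
  have "bitension sphere_metric sphere_metric \<phi> x
     = vector [(1 - k\<^sup>2) * (2 * c / s ^ 3) + 1 / s\<^sup>2 * (- (s * c * k * ((1 - k\<^sup>2) * (k * (c / s)\<^sup>2)))
          - (1 - k\<^sup>2) * (s * c / s\<^sup>2)) + 1 / s\<^sup>2 * (k * k * s\<^sup>2 * ((1 - k\<^sup>2) * (c / s))), 0]"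
    unfolding bitension_def metric_trace_sphere[OF x] second pullback_conn_tension[OF x]
      curvature_sphere[OF map_polar_chart[OF x]] push_eq levi_civita_sphere_const[OF x] tension_eq[OF x]
    by (simp add: vec_eq_iff forall_2 axis_def matrix_vector_mult_def inner_vec_def sum_2
        sphere_metric_eq \<phi> s_def[symmetric] c_def[symmetric])
  also have "\<dots> = ((1 - k\<^sup>2) * (c / s ^ 3) * (1 - k\<^sup>2 + 2 * k\<^sup>2 * s\<^sup>2)) *\<^sub>R axis 1 1"
    unfolding div unfolding k2 vec_eq_iff forall_2 vector_2 vector_scaleR_component real_scaleR_def axis
  proof
    show "(1 - k * k) * (2 * c * i * i * i)
        + 1 * i * i * (- (s * c * k * ((1 - k * k) * (k * (c * i * (c * i))))) - (1 - k * k) * (s * c * i * i))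
        + 1 * i * i * (k * k * (s * s) * ((1 - k * k) * (c * i)))
      = (1 - k * k) * (c * i * i * i) * (1 - k * k + 2 * (k * k) * (s * s)) * 1"
      using i c by algebra
  qed simp
  finally show ?thesis by (simp add: s_def c_def)
qed

text \<open>
  For a weight that depends on \<open>r\<close> only, the angular component of the equation vanishes
  identically: the gradient of the weight is radial, and so are the tension and the bitension.
  What remains is one linear ordinary differential equation of second order.
\<close>

lemma f_biharmonic_operator:
  assumes M: "open M" "M \<subseteq> polar_chart" and x: "x \<in> M"
    and f: "\<And>y. y \<in> M \<Longrightarrow> f y = F (y $ 1)"
    and F1: "\<And>y. y \<in> M \<Longrightarrow> (F has_real_derivative F1 (y $ 1)) (at (y $ 1))"
    and F2: "(F1 has_real_derivative F2) (at (x $ 1))"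
  shows "f x *\<^sub>R bitension sphere_metric sphere_metric \<phi> x
      + laplacian sphere_metric f x *\<^sub>R tension sphere_metric sphere_metric \<phi> x
      + 2 *\<^sub>R pullback_conn sphere_metric \<phi> (gradient sphere_metric f) (tension sphere_metric sphere_metric \<phi>) x
    = ((1 - k\<^sup>2) *
        (F (x $ 1) * (cos (x $ 1) / (sin (x $ 1)) ^ 3) * (1 - k\<^sup>2 + 2 * k\<^sup>2 * (sin (x $ 1))\<^sup>2)
         + (F2 + cos (x $ 1) / sin (x $ 1) * F1 (x $ 1)) * (cos (x $ 1) / sin (x $ 1))
         - 2 * F1 (x $ 1) / (sin (x $ 1))\<^sup>2)) *\<^sub>R axis 1 1"
proof -
  have xp: "x \<in> polar_chart" using M x by blast
  have s: "sin (x $ 1) \<noteq> 0" using polar_chart_sin_pos[OF xp] by simp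
  have df: "frechet_derivative f (at y) = (\<lambda>v. F1 (y $ 1) * v $ 1)" if "y \<in> M" for y
    by (rule frechet_derivative_at[symmetric],
        rule has_derivative_transform_within_open[OF has_derivative_nth1[OF F1[OF that]] M(1) that])
      (simp add: f)
  have ddf: "frechet_derivative (\<lambda>y. frechet_derivative f (at y) v) (at x) u = F2 * v $ 1 * u $ 1" for u v
  proof -
    have "((\<lambda>r. F1 r * v $ 1) has_real_derivative F2 * v $ 1) (at (x $ 1))"
      by (rule DERIV_cmult_right[OF F2])
    then have "((\<lambda>y. frechet_derivative f (at y) v) has_derivative (\<lambda>u. F2 * v $ 1 * u $ 1)) (at x)"
      by (rule has_derivative_transform_within_open[OF has_derivative_nth1 M(1) x]) (simp add: df)
    from frechet_derivative_at[OF this] show ?thesis by (rule fun_cong[OF sym])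
  qed
  have grad: "gradient sphere_metric f x = F1 (x $ 1) *\<^sub>R axis 1 1"
    by (simp add: gradient_def sum_2 inv_sphere_metric[OF xp] partial_def df[OF x] vec_eq_iff forall_2 axis_def)
  have lap: "laplacian sphere_metric f x = F2 + cos (x $ 1) / sin (x $ 1) * F1 (x $ 1)"
    unfolding laplacian_def metric_trace_sphere[OF xp] ddf df[OF x] levi_civita_sphere_const[OF xp]
    using s by (simp add: axis_def power2_eq_square)
  show ?thesis
    unfolding bitension_eq[OF xp] tension_eq[OF xp] pullback_conn_tension[OF xp] grad lap f[OF x]
    by (simp add: vec_eq_iff forall_2 axis_def algebra_simps add_divide_distrib diff_divide_distrib)
qed

end

section \<open>The weight and its differential equation\<close>

text \<open>
  The power \<open>tan (r / 2) powr (- sqrt 3)\<close>, written with \<open>exp\<close>, \<open>ln\<close>, \<open>sin\<close> and \<open>cos\<close> so that it is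
  visibly elementary.
\<close>

definition tan_half_pow :: "real \<Rightarrow> real" where
  "tan_half_pow r = exp (- sqrt 3 * ln (sin (r / 2) / cos (r / 2)))"

text \<open>
  The weight is this function divided by \<open>cos r\<close>.  Keeping the numerator apart separates the two
  kinds of singularity: the numerator is smooth on the whole interval and vanishes only where
  \<open>sqrt 3 * cos r = 1\<close>, while the pole at \<open>pi / 2\<close> comes from the denominator.
\<close>

definition weight_numerator :: "real \<Rightarrow> real" where
  "weight_numerator r = - (sqrt 3 - 1) * (2 - sqrt 3) / 4 *
     (tan_half_pow r * (sin r * ((1 - sqrt 3 * cos r) * (2 - sqrt 3 * cos r))))"

lemma half_angle_pos:
  assumes "0 < r" "r < pi"
  shows "sin (r / 2) > 0" "cos (r / 2) > 0"
  using assms by (auto intro!: sin_gt_zero cos_gt_zero)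

lemma cos_eq_zero_iff_half_pi:
  assumes "0 < r" "r < pi"
  shows "cos r = 0 \<longleftrightarrow> r = pi / 2"
proof
  show "r = pi / 2" if "cos r = 0"
    using cos_inj_pi[of r "pi / 2"] assms that by simp
  show "cos r = 0" if "r = pi / 2"
    unfolding that by (rule cos_pi_half)
qed

lemma sqrt3_bounds: "sqrt 3 * sqrt 3 = (3::real)" "1 < sqrt (3::real)" "sqrt (3::real) < 2"
proof -
  show "sqrt 3 < (2::real)" by (rule real_less_lsqrt) simp_all
qed simp_all

text \<open>
  Substituting \<open>t = tan (r / 2)\<close>, \<open>cos r = (1 - t\<^sup>2) / (1 + t\<^sup>2)\<close> and \<open>sin r = 2 t / (1 + t\<^sup>2)\<close> makes
  this an identity of rational functions in \<open>t\<close> over the field generated by \<open>sqrt 3\<close>.  In terms of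
  \<open>cos r\<close> the two quadratic factors in \<open>t\<close> become \<open>2 - sqrt 3 * cos r\<close> and \<open>1 - sqrt 3 * cos r\<close>
  up to constants and powers of \<open>1 + cos r\<close>; the constants account for the leading coefficient of
  the numerator.
\<close>

lemma weight_formula:
  assumes r: "0 < r" "r < pi" and c0: "cos r \<noteq> 0"
  shows "tan (r / 2) powr (1 - sqrt 3) * ((tan (r / 2))\<^sup>2 + 7 - 4 * sqrt 3) * ((tan (r / 2))\<^sup>2 - 2 + sqrt 3)
      / ((1 + (tan (r / 2))\<^sup>2)\<^sup>2 * ((tan (r / 2))\<^sup>2 - 1)) = weight_numerator r / cos r"
proof -
  define t c q where "t = tan (r / 2)" and "c = cos r" and "q = sqrt (3::real)"
  note half = half_angle_pos[OF r]
  have t: "t > 0" unfolding t_def tan_def using half by simp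
  have P: "t powr (1 - q) = t * tan_half_pow r"
    using t by (simp add: powr_def tan_half_pow_def t_def tan_def q_def exp_add[symmetric] algebra_simps exp_diff)
      (simp add: exp_minus field_simps)
  have q: "q * q = 3" by (simp add: q_def)
  have ct: "(cos (r / 2))\<^sup>2 * (1 + t\<^sup>2) = 1"
    using half sin_cos_squared_add[of "r / 2"] by (simp add: t_def tan_def power_divide field_simps)
  have c: "c * (1 + t\<^sup>2) = 1 - t\<^sup>2"
  proof -
    have "c = 2 * (cos (r / 2))\<^sup>2 - 1"
      unfolding c_def using cos_double_cos[of "r / 2"] by simp
    then show ?thesis using ct by algebra
  qed
  have s: "sin r * (1 + t\<^sup>2) = 2 * t"
  proof -
    have "sin r = 2 * sin (r / 2) * cos (r / 2)"
      using sin_double[of "r / 2"] by simp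
    moreover have "sin (r / 2) = t * cos (r / 2)" using half by (simp add: t_def tan_def)
    ultimately show ?thesis using ct by algebra
  qed
  have t1: "1 + t\<^sup>2 \<noteq> 0" by (metis add_pos_nonneg less_irrefl zero_le_power2 zero_less_one)
  have c0': "c \<noteq> 0" using c0 by (simp add: c_def)
  have t2: "t\<^sup>2 - 1 \<noteq> 0" using c c0' t1 by auto
  have "t * tan_half_pow r * (t\<^sup>2 + 7 - 4 * q) * (t\<^sup>2 - 2 + q) * c
      = weight_numerator r * ((1 + t\<^sup>2)\<^sup>2 * (t\<^sup>2 - 1))"
  proof -
    define m where "m = 1 / (1 + t\<^sup>2)"
    have m: "m * (1 + t\<^sup>2) = 1" using t1 by (simp add: m_def)
    have c': "c = (1 - t\<^sup>2) * m" using c m by algebra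
    have s': "sin r = 2 * t * m" using s m by algebra
    have "t * (t\<^sup>2 + 7 - 4 * q) * (t\<^sup>2 - 2 + q) * c * 4
      = - (q - 1) * (2 - q) * (sin r * ((1 - q * c) * (2 - q * c))) * ((1 + t\<^sup>2)\<^sup>2 * (t\<^sup>2 - 1))"
      unfolding c' s' using m q by algebra
    then show ?thesis
      unfolding weight_numerator_def q_def[symmetric] c_def[symmetric] by algebra
  qed
  then show ?thesis
    unfolding t_def[symmetric] c_def[symmetric] q_def[symmetric] P using t1 t2 c0'
    by (simp add: frac_eq_eq)
qed

text \<open>
  The logarithm of \<open>tan (r / 2)\<close> has derivative \<open>1 / sin r\<close>.  Hence derivatives of the weight are
  again this power times a rational expression in \<open>sin r\<close> and \<open>cos r\<close>.
\<close>

lemma DERIV_tan_half_pow: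
  assumes r: "0 < r" "r < pi"
  shows "(tan_half_pow has_real_derivative - sqrt 3 * tan_half_pow r / sin r) (at r)"
proof -
  note half = half_angle_pos[OF r]
  let ?S = "sin (r / 2)" and ?C = "cos (r / 2)"
  have s: "sin r = 2 * ?S * ?C" using sin_double[of "r / 2"] by simp
  have "((\<lambda>r. sin (r / 2) / cos (r / 2)) has_real_derivative (?C * ?C + ?S * ?S) / 2 / (?C * ?C)) (at r)"
    using half by (auto intro!: derivative_eq_intros simp: field_simps)
  then have "((\<lambda>r. sin (r / 2) / cos (r / 2)) has_real_derivative 1 / (2 * (?C * ?C))) (at r)"
    by simp
  from DERIV_chain2[OF DERIV_ln this, of]
  have "((\<lambda>r. ln (sin (r / 2) / cos (r / 2))) has_real_derivative 1 / sin r) (at r)"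
    using half by (simp add: s field_simps)
  from DERIV_chain2[OF DERIV_exp DERIV_cmult[OF this, of "- sqrt 3"]] show ?thesis
    unfolding tan_half_pow_def by (simp add: mult_ac)
qed

definition weight :: "real \<Rightarrow> real" where
  "weight r = weight_numerator r / cos r"

text \<open>
  The derivative of the weight, simplified with \<open>sin\<^sup>2 = 1 - cos\<^sup>2\<close> to an expression in which the
  sine no longer occurs beside the power of the tangent.
\<close>

definition weight' :: "real \<Rightarrow> real" where
  "weight' r = - (sqrt 3 - 1) * (2 - sqrt 3) / 4 *
     (tan_half_pow r * (2 / (cos r)\<^sup>2 - 2 * sqrt 3 / cos r + (6 - 6 * sqrt 3 * cos r + 6 * (cos r)\<^sup>2)))"

lemma DERIV_weight:
  assumes r: "0 < r" "r < pi" and c0: "cos r \<noteq> 0"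
  shows "(weight has_real_derivative weight' r) (at r)"
proof -
  have s0: "sin r \<noteq> 0" using sin_gt_zero[OF r] by simp
  define q m i where "q = sqrt (3::real)" and "m = 1 / cos r" and "i = 1 / sin r"
  have q: "q * q = 3" by (simp add: q_def)
  have mi: "m * cos r = 1" "i * sin r = 1" using c0 s0 by (simp_all add: m_def i_def)
  have div: "y / cos r = y * m" "y / (cos r)\<^sup>2 = y * m * m" "y / sin r = y * i" for y
    by (simp_all add: m_def i_def power2_eq_square)
  let ?Q = "\<lambda>r. (1 - q * cos r) * (2 - q * cos r)"
  note P = DERIV_tan_half_pow[OF r, folded q_def]
  have "((\<lambda>r. tan_half_pow r * (sin r * ?Q r) / cos r) has_real_derivative
      ((- q * tan_half_pow r / sin r) * (sin r * ?Q r)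
       + (cos r * ?Q r + (q * sin r * (2 - q * cos r) + q * sin r * (1 - q * cos r)) * sin r) * tan_half_pow r) / cos r
      + tan_half_pow r * (sin r * ?Q r) * sin r / (cos r)\<^sup>2) (at r)"
    using c0 s0 by (auto intro!: derivative_eq_intros P simp: field_simps power2_eq_square)
  moreover have "((- q * tan_half_pow r / sin r) * (sin r * ?Q r)
       + (cos r * ?Q r + (q * sin r * (2 - q * cos r) + q * sin r * (1 - q * cos r)) * sin r) * tan_half_pow r) / cos r
      + tan_half_pow r * (sin r * ?Q r) * sin r / (cos r)\<^sup>2
    = tan_half_pow r * (2 / (cos r)\<^sup>2 - 2 * q / cos r + (6 - 6 * q * cos r + 6 * (cos r)\<^sup>2))"
    unfolding div using mi q sin_cos_squared_add[of r] by algebra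
  ultimately have "((\<lambda>r. tan_half_pow r * (sin r * ?Q r) / cos r) has_real_derivative
      tan_half_pow r * (2 / (cos r)\<^sup>2 - 2 * q / cos r + (6 - 6 * q * cos r + 6 * (cos r)\<^sup>2))) (at r)"
    by simp
  from DERIV_cmult[OF this, of "- (q - 1) * (2 - q) / 4"] show ?thesis
    unfolding weight_def[abs_def] weight_numerator_def weight'_def q_def[symmetric] by (simp add: mult.assoc)
qed

definition weight'' :: "real \<Rightarrow> real" where
  "weight'' r = - (sqrt 3 - 1) * (2 - sqrt 3) / 4 *
     (tan_half_pow r * (4 * sin r / (cos r) ^ 3 - 2 * sqrt 3 * sin r / (cos r)\<^sup>2 + (6 * sqrt 3 * sin r - 12 * cos r * sin r)
        - sqrt 3 / sin r * (2 / (cos r)\<^sup>2 - 2 * sqrt 3 / cos r + (6 - 6 * sqrt 3 * cos r + 6 * (cos r)\<^sup>2))))"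

lemma DERIV_weight':
  assumes r: "0 < r" "r < pi" and c0: "cos r \<noteq> 0"
  shows "(weight' has_real_derivative weight'' r) (at r)"
proof -
  have s0: "sin r \<noteq> 0" using sin_gt_zero[OF r] by simp
  define q where "q = sqrt (3::real)"
  note P = DERIV_tan_half_pow[OF r, folded q_def]
  have m2: "((\<lambda>r. 2 / (cos r)\<^sup>2) has_real_derivative 4 * sin r / (cos r) ^ 3) (at r)"
    using c0 by (auto intro!: derivative_eq_intros simp: field_simps power2_eq_square power3_eq_cube)
  have m1: "((\<lambda>r. 2 * q / cos r) has_real_derivative 2 * q * sin r / (cos r)\<^sup>2) (at r)"
    using c0 by (auto intro!: derivative_eq_intros simp: field_simps power2_eq_square)
  have "((\<lambda>r. 2 / (cos r)\<^sup>2 - 2 * q / cos r + (6 - 6 * q * cos r + 6 * (cos r)\<^sup>2)) has_real_derivative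
      4 * sin r / (cos r) ^ 3 - 2 * q * sin r / (cos r)\<^sup>2 + (6 * q * sin r - 12 * cos r * sin r)) (at r)"
    by (rule DERIV_add[OF DERIV_diff[OF m2 m1]]) (auto intro!: derivative_eq_intros)
  from DERIV_mult[OF P this]
  have "((\<lambda>r. tan_half_pow r * (2 / (cos r)\<^sup>2 - 2 * q / cos r + (6 - 6 * q * cos r + 6 * (cos r)\<^sup>2))) has_real_derivative
      tan_half_pow r * (4 * sin r / (cos r) ^ 3 - 2 * q * sin r / (cos r)\<^sup>2 + (6 * q * sin r - 12 * cos r * sin r)
        - q / sin r * (2 / (cos r)\<^sup>2 - 2 * q / cos r + (6 - 6 * q * cos r + 6 * (cos r)\<^sup>2)))) (at r)"
    by (rule back_subst[where P = "\<lambda>d. (_ has_real_derivative d) (at r)"])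
      (simp add: right_diff_distrib mult_ac)
  from DERIV_cmult[OF this, of "- (q - 1) * (2 - q) / 4"] show ?thesis
    unfolding weight'_def[abs_def] weight''_def q_def[symmetric] .
qed

text \<open>
  The equation left by \<open>f_biharmonic_operator\<close> for \<open>k\<^sup>2 = 3\<close>.  The power of \<open>tan (r / 2)\<close> is a common
  factor of all terms, and what is left is a rational identity in \<open>sin r\<close>, \<open>cos r\<close> and \<open>sqrt 3\<close>
  modulo \<open>sin\<^sup>2 + cos\<^sup>2 = 1\<close>.
\<close>

lemma weight_ode:
  assumes r: "0 < r" "r < pi" and c0: "cos r \<noteq> 0"
  shows "weight r * (cos r / (sin r) ^ 3) * (1 - 3 + 2 * 3 * (sin r)\<^sup>2)
      + (weight'' r + cos r / sin r * weight' r) * (cos r / sin r)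
      - 2 * weight' r / (sin r)\<^sup>2 = 0"
proof -
  have s0: "sin r \<noteq> 0" using sin_gt_zero[OF r] by simp
  define q m i where "q = sqrt (3::real)" and "m = 1 / cos r" and "i = 1 / sin r"
  have q: "q * q = 3" by (simp add: q_def)
  have mi: "m * cos r = 1" "i * sin r = 1" using c0 s0 by (simp_all add: m_def i_def)
  have div: "y / cos r = y * m" "y / (cos r)\<^sup>2 = y * m * m" "y / (cos r) ^ 3 = y * m * m * m"
    "y / sin r = y * i" "y / (sin r)\<^sup>2 = y * i * i" "y / (sin r) ^ 3 = y * i * i * i" for y
    by (simp_all add: m_def i_def power2_eq_square power3_eq_cube)
  define K where "K = - (q - 1) * (2 - q) / 4 * tan_half_pow r"
  have w: "weight r = K * (sin r * ((1 - q * cos r) * (2 - q * cos r))) * m"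
    "weight' r = K * (2 * m * m - 2 * q * m + (6 - 6 * q * cos r + 6 * (cos r)\<^sup>2))"
    "weight'' r = K * (4 * sin r * m * m * m - 2 * q * sin r * m * m + (6 * q * sin r - 12 * cos r * sin r)
        - q * i * (2 * m * m - 2 * q * m + (6 - 6 * q * cos r + 6 * (cos r)\<^sup>2)))"
    unfolding weight_def weight_numerator_def weight'_def weight''_def q_def[symmetric] K_def div
    by (simp_all only: mult.assoc)
  show ?thesis
    unfolding w div using mi q sin_cos_squared_add[of r] by algebra
qed

section \<open>Zeros of the weight and loss of smoothness\<close>

lemma weight_zero_iff:
  assumes r: "0 < r" "r < pi"
  shows "weight_numerator r = 0 \<longleftrightarrow> sqrt 3 * cos r = 1"
proof -
  have "sqrt 3 * cos r < 2"
    using mult_left_mono[OF cos_le_one, of "sqrt 3" r] sqrt3_bounds by linarith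
  moreover have "tan_half_pow r \<noteq> 0" "sin r \<noteq> 0"
    using sin_gt_zero[OF r] by (simp_all add: tan_half_pow_def)
  ultimately show ?thesis
    using sqrt3_bounds by (auto simp: weight_numerator_def)
qed

text \<open>
  The half-angle formula gives \<open>cos r = (1 - t\<^sup>2) / (1 + t\<^sup>2) = (sqrt 3 - 1) / (3 - sqrt 3)\<close> for
  \<open>t\<^sup>2 = 2 - sqrt 3\<close>, which is \<open>1 / sqrt 3\<close>; the cosine is injective on \<open>{0..pi}\<close>.
\<close>

lemma sqrt3_cos_eq_one_iff:
  assumes r: "0 < r" "r < pi"
  shows "sqrt 3 * cos r = 1 \<longleftrightarrow> r = 2 * arctan (sqrt (2 - sqrt 3))"
proof -
  define t where "t = sqrt (2 - sqrt (3::real))"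
  have t2: "t\<^sup>2 = 2 - sqrt 3" and t0: "t > 0"
    using sqrt3_bounds by (simp_all add: t_def)
  have a: "0 < 2 * arctan t" "2 * arctan t < pi"
    using t0 arctan_ubound[of t] by simp_all
  have "cos (2 * arctan t) = 2 * (cos (arctan t))\<^sup>2 - 1"
    by (rule cos_double_cos)
  also have "\<dots> = 2 / (1 + t\<^sup>2) - 1"
    by (simp add: cos_arctan power_divide)
  finally have "sqrt 3 * cos (2 * arctan t) = sqrt 3 * (2 / (3 - sqrt 3) - 1)"
    by (simp add: t2)
  also have "\<dots> = 1"
    using sqrt3_bounds by (simp add: field_simps)
  finally have c: "sqrt 3 * cos (2 * arctan t) = 1" .
  have "r = 2 * arctan t" if "sqrt 3 * cos r = 1"
  proof -
    have "cos r = cos (2 * arctan t)" using that c by (metis mult_left_cancel mult_zero_left zero_neq_one)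
    then show ?thesis using cos_inj_pi[of r "2 * arctan t"] r a by simp
  qed
  then show ?thesis using c unfolding t_def by auto
qed

lemma DERIV_sgn_comp:
  fixes g :: "real \<Rightarrow> real"
  assumes "isCont g a" "g a \<noteq> 0"
  shows "((\<lambda>r. sgn (g r)) has_real_derivative 0) (at a)"
proof -
  have lim: "(g \<longlongrightarrow> g a) (nhds a)"
    using assms(1) by (simp add: isCont_def tendsto_at_iff_tendsto_nhds)
  have "\<forall>\<^sub>F r in nhds a. sgn (g r) = sgn (g a)"
  proof (cases "g a > 0")
    case True
    have "\<forall>\<^sub>F r in nhds a. g r > 0"
      by (rule order_tendstoD(1)[OF lim True])
    then show ?thesis by eventually_elim (use True in simp)
  next
    case False
    then have "g a < 0" using assms(2) by simp
    have "\<forall>\<^sub>F r in nhds a. g r < 0"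
      by (rule order_tendstoD(2)[OF lim \<open>g a < 0\<close>])
    then show ?thesis by eventually_elim (use \<open>g a < 0\<close> in simp)
  qed
  from DERIV_cong_ev[OF refl this refl] show ?thesis by simp
qed

text \<open>
  A zero of \<open>g\<close> is a minimum of \<open>\<bar>g\<bar>\<close>, so a derivative of \<open>\<bar>g\<bar>\<close> there can only be \<open>0\<close>, whereas the
  difference quotients of \<open>g\<close> and \<open>\<bar>g\<bar>\<close> have the same absolute value.  So the absolute value of a
  function with a simple zero is not differentiable.
\<close>

lemma DERIV_abs_at_zero:
  fixes g :: "real \<Rightarrow> real"
  assumes g: "(g has_real_derivative d) (at a)" "g a = 0"
    and e: "((\<lambda>r. \<bar>g r\<bar>) has_real_derivative e) (at a)"
  shows "d = 0"
proof -
  have "e = 0"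
    by (rule DERIV_local_min[OF e zero_less_one]) (simp add: g(2))
  have "((\<lambda>y. \<bar>g y / (y - a)\<bar>) \<longlongrightarrow> \<bar>d\<bar>) (at a)"
    using tendsto_rabs[OF g(1)[unfolded has_field_derivative_iff]] by (simp add: g(2))
  moreover have "((\<lambda>y. \<bar>g y / (y - a)\<bar>) \<longlongrightarrow> \<bar>0\<bar>) (at a)"
    using tendsto_rabs[OF e[unfolded has_field_derivative_iff]] by (simp add: g(2) \<open>e = 0\<close>)
  ultimately show ?thesis
    using tendsto_unique[of "at a"] by fastforce
qed

lemma differentiable_along_axis:
  fixes f :: "real ^ 'n \<Rightarrow> real"
  assumes "f differentiable (at x)"
  shows "(\<lambda>r. f (x + (r - x $ i) *\<^sub>R axis i 1)) differentiable (at (x $ i))"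
proof (rule differentiable_compose[of f])
  have "((\<lambda>r. x + (r - x $ i) *\<^sub>R axis i 1) has_derivative (\<lambda>h. h *\<^sub>R axis i (1::real))) (at (x $ i))"
    by (auto intro!: derivative_eq_intros)
  then show "(\<lambda>r. x + (r - x $ i) *\<^sub>R axis i 1) differentiable (at (x $ i))"
    by (rule differentiableI)
qed (simp add: assms)

lemma isCont_weight_numerator:
  assumes r: "0 < r" "r < pi"
  shows "isCont weight_numerator r"
proof -
  have "isCont tan_half_pow r" using DERIV_tan_half_pow[OF r] by (rule DERIV_isCont)
  then show ?thesis unfolding weight_numerator_def[abs_def] by (intro continuous_intros)
qed

lemma weight_numerator_elementary:
  assumes "I \<subseteq> {0<..<pi}"
  shows "elementary_on I weight_numerator"
proof -
  have half: "sin (r / 2) > 0" "cos (r / 2) > 0" if "r \<in> I" for r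
    using half_angle_pos[of r] assms that by auto
  have "cos (r / 2) \<noteq> 0" if "r \<in> I" for r
    using half(2)[OF that] by simp
  then show ?thesis
    unfolding weight_numerator_def[abs_def] tan_half_pow_def
    by (intro elementary_intros) (simp_all add: half)
qed

text \<open>
  The sign of the weight is constant near each point of \<open>M\<close>, so it multiplies the first two
  derivatives of the weight as a constant would, and the linear equation survives the passage to
  the absolute value.  Of the two radii removed from the chart, one is excluded because the weight
  is unbounded there and the other because it has a simple zero.
\<close>

theorem theorem3p5:
  fixes f :: "real ^ 2 \<Rightarrow> real" and \<phi> :: "real ^ 2 \<Rightarrow> real ^ 2" and M :: "(real ^ 2) set"
  assumes \<phi>: "\<And>x. \<phi> x = vector [x $ 1, - sqrt 3 * x $ 2]"
    and f: "\<And>x. x \<in> polar_chart \<Longrightarrow> x $ 1 \<noteq> pi / 2 \<Longrightarrow>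
      f x = \<bar>(tan (x $ 1 / 2)) powr (1 - sqrt 3)
               * ((tan (x $ 1 / 2))\<^sup>2 + 7 - 4 * sqrt 3)
               * ((tan (x $ 1 / 2))\<^sup>2 - 2 + sqrt 3)
             / ((1 + (tan (x $ 1 / 2))\<^sup>2)\<^sup>2 * ((tan (x $ 1 / 2))\<^sup>2 - 1))\<bar>"
    and M: "M = {x \<in> polar_chart. x $ 1 \<noteq> pi / 2 \<and> x $ 1 \<noteq> 2 * arctan (sqrt (2 - sqrt 3))}"
  shows "(\<forall>x\<in>polar_chart. smooth_at f x \<longleftrightarrow> x \<in> M) \<and>
         proper_f_biharmonic_map M sphere_metric polar_chart sphere_metric f \<phi>"
proof -
  interpret angle_scaling "- sqrt 3" \<phi>
    by unfold_locales (simp add: \<phi>)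
  define r\<^sub>0 where "r\<^sub>0 = 2 * arctan (sqrt (2 - sqrt 3))"
  \<comment> \<open>The radii of the points of \<open>M\<close>.\<close>
  define I where "I = {0<..<pi} - {pi / 2, r\<^sub>0}"
  have fw: "f x = \<bar>weight (x $ 1)\<bar>" if "x \<in> polar_chart" "x $ 1 \<noteq> pi / 2" for x
  proof -
    have r: "0 < x $ 1" "x $ 1 < pi" using that(1) by (simp_all add: polar_chart_def)
    moreover have "cos (x $ 1) \<noteq> 0" using cos_eq_zero_iff_half_pi[OF r] that(2) by simp
    ultimately show ?thesis unfolding f[OF that] weight_def by (simp add: weight_formula)
  qed
  have MI: "M = (\<lambda>x. x $ 1) -` I" by (auto simp: M I_def polar_chart_def r\<^sub>0_def)
  have open_M: "open M"
    unfolding MI I_def by (intro open_vimage_vec_nth open_Diff finite_imp_closed) simp_all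
  have M_sub: "M \<subseteq> polar_chart" by (auto simp: M)
  have I: "0 < r" "r < pi" "cos r \<noteq> 0" "weight_numerator r \<noteq> 0" "weight r \<noteq> 0" if "r \<in> I" for r
  proof -
    show r: "0 < r" "r < pi" using that by (auto simp: I_def)
    show c: "cos r \<noteq> 0" using cos_eq_zero_iff_half_pi[OF r] that by (auto simp: I_def)
    show "weight_numerator r \<noteq> 0"
      using weight_zero_iff[OF r] sqrt3_cos_eq_one_iff[OF r] that by (auto simp: I_def r\<^sub>0_def)
    with c show "weight r \<noteq> 0" by (simp add: weight_def)
  qed
  have fM: "f x = \<bar>weight (x $ 1)\<bar>" if "x \<in> M" for x
    using fw that by (auto simp: M)
  have MI': "x $ 1 \<in> I" if "x \<in> M" for x using that by (simp add: MI)
  have sgn: "((\<lambda>r. sgn (weight r)) has_real_derivative 0) (at r)" if "r \<in> I" for r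
    by (rule DERIV_sgn_comp[OF DERIV_isCont[OF DERIV_weight[OF I(1-3)[OF that]]] I(5)[OF that]])

  have smooth_f: "smooth_on M f"
  proof (rule smooth_on_radial[OF open_M, where i = 1 and I = I and C = 0 and E = 1])
    show "elementary_on I (\<lambda>r. sgn (weight r) * (weight_numerator r / cos r))"
      by (rule elementary_on.mult[OF elementary_on.locally_constant[OF sgn]
            elementary_on.divide[OF weight_numerator_elementary
              elementary_on.cos[OF elementary_on.ident] I(3)]]) (auto simp: I_def)
    show "f y = 0 + (sgn (weight (y $ 1)) * (weight_numerator (y $ 1) / cos (y $ 1))) *\<^sub>R 1" if "y \<in> M" for y
      using fM[OF that] by (simp add: weight_def abs_sgn mult.commute)
  qed (rule MI')

  have "x \<in> M" if x: "x \<in> polar_chart" and s: "smooth_at f x" for x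
  proof (rule ccontr)
    assume xM: "x \<notin> M"
    have r: "0 < x $ 1" "x $ 1 < pi" using x by (simp_all add: polar_chart_def)
    define u where "u = (\<lambda>r. f (x + (r - x $ 1) *\<^sub>R axis 1 1))"
    have u: "u differentiable (at (x $ 1))"
      unfolding u_def by (rule differentiable_along_axis[OF smooth_at_imp_differentiable[OF s]])
    have uw: "u r = \<bar>weight r\<bar>" if "0 < r" "r < pi" "r \<noteq> pi / 2" for r
      unfolding u_def using that by (subst fw) (auto simp: polar_chart_def)
    have "x $ 1 = pi / 2 \<or> x $ 1 = r\<^sub>0"
      using x xM by (simp add: M r\<^sub>0_def)
    then consider (pole) "x $ 1 = pi / 2" | (kink) "x $ 1 = r\<^sub>0" "x $ 1 \<noteq> pi / 2"
      by blast
    then show False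
    proof cases
      case pole
      \<comment> \<open>Whatever value \<open>f\<close> takes there, continuity would make \<open>u r * \<bar>cos r\<bar>\<close> tend to \<open>0\<close>,
        but away from \<open>pi / 2\<close> this is \<open>\<bar>weight_numerator r\<bar>\<close>, with a positive limit.\<close>
      have "isCont u (pi / 2)"
        using differentiable_imp_continuous_within[OF u] pole by simp
      then have "((\<lambda>r. u r * \<bar>cos r\<bar>) \<longlongrightarrow> u (pi / 2) * \<bar>cos (pi / 2)\<bar>) (at (pi / 2))"
        by (intro tendsto_intros) (simp add: isCont_def)
      moreover have "\<forall>\<^sub>F r in at (pi / 2). u r * \<bar>cos r\<bar> = \<bar>weight_numerator r\<bar>"
        unfolding eventually_at_topological
      proof (intro exI[of _ "{0<..<pi}"] conjI ballI impI)
        fix r :: real assume a: "r \<in> {0<..<pi}" "r \<noteq> pi / 2"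
        then have "cos r \<noteq> 0" using cos_eq_zero_iff_half_pi[of r] by simp
        then show "u r * \<bar>cos r\<bar> = \<bar>weight_numerator r\<bar>"
          using a uw[of r] by (simp add: weight_def)
      qed simp_all
      ultimately have "((\<lambda>r. \<bar>weight_numerator r\<bar>) \<longlongrightarrow> 0) (at (pi / 2))"
        by (simp add: filterlim_cong[OF refl refl])
      moreover have "((\<lambda>r. \<bar>weight_numerator r\<bar>) \<longlongrightarrow> \<bar>weight_numerator (pi / 2)\<bar>) (at (pi / 2))"
        using isCont_weight_numerator[of "pi / 2"] by (intro tendsto_rabs) (simp add: isCont_def)
      ultimately have "weight_numerator (pi / 2) = 0"
        using tendsto_unique[of "at (pi / 2)"] by fastforce
      then show False using weight_zero_iff[of "pi / 2"] by simp
    next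
      case kink
      have c0: "cos (x $ 1) \<noteq> 0" using cos_eq_zero_iff_half_pi[OF r] kink(2) by simp
      have c: "sqrt 3 * cos (x $ 1) = 1" using sqrt3_cos_eq_one_iff[OF r] kink(1) by (simp add: r\<^sub>0_def)
      obtain e where "(u has_real_derivative e) (at (x $ 1))"
        using u by (auto simp: real_differentiable_def)
      then have "((\<lambda>r. \<bar>weight r\<bar>) has_real_derivative e) (at (x $ 1))"
        by (rule has_field_derivative_transform_within_open[where S = "{0<..<pi} - {pi / 2}"])
          (use r kink(2) in \<open>auto simp: uw open_Diff\<close>)
      moreover have "weight (x $ 1) = 0"
        using weight_zero_iff[OF r] c by (simp add: weight_def)
      ultimately have "weight' (x $ 1) = 0"
        using DERIV_abs_at_zero[OF DERIV_weight[OF r c0]] by blast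
      \<comment> \<open>At this radius the last factor of \<open>weight'\<close> has the value \<open>6 - 6 + (6 - 6 + 2) = 2\<close>, so
        the zero is simple.\<close>
      moreover have "1 / cos (x $ 1) = sqrt 3" using c c0 by (simp add: field_simps)
      moreover have "weight' (x $ 1) = - (sqrt 3 - 1) * (2 - sqrt 3) / 4 * (tan_half_pow (x $ 1) *
          (2 * (1 / cos (x $ 1))\<^sup>2 - 2 * sqrt 3 * (1 / cos (x $ 1)) + (6 - 6 * (sqrt 3 * cos (x $ 1))
            + 2 * (sqrt 3 * cos (x $ 1))\<^sup>2)))"
        by (simp add: weight'_def power_divide power_mult_distrib)
      ultimately show False
        using sqrt3_bounds c by (simp add: tan_half_pow_def)
    qed
  qed
  then have smooth: "\<forall>x\<in>polar_chart. smooth_at f x \<longleftrightarrow> x \<in> M"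
    using smooth_f open_M by (auto simp: smooth_at_def)

  have eq: "f x *\<^sub>R bitension sphere_metric sphere_metric \<phi> x
      + laplacian sphere_metric f x *\<^sub>R tension sphere_metric sphere_metric \<phi> x
      + 2 *\<^sub>R pullback_conn sphere_metric \<phi> (gradient sphere_metric f) (tension sphere_metric sphere_metric \<phi>) x = 0"
    if x: "x \<in> M" for x
  proof -
    let ?r = "x $ 1"
    have DF1: "((\<lambda>r. \<bar>weight r\<bar>) has_real_derivative sgn (weight r) * weight' r) (at r)" if "r \<in> I" for r
      using DERIV_mult[OF sgn[OF that] DERIV_weight[OF I(1-3)[OF that]]]
      by (simp add: abs_sgn mult.commute)
    have DF2: "((\<lambda>r. sgn (weight r) * weight' r) has_real_derivative sgn (weight r) * weight'' r) (at r)"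
      if "r \<in> I" for r
      using DERIV_mult[OF sgn[OF that] DERIV_weight'[OF I(1-3)[OF that]]]
      by (simp add: mult.commute)
    have "\<bar>weight ?r\<bar> * (cos ?r / (sin ?r) ^ 3) * (1 - (- sqrt 3)\<^sup>2 + 2 * (- sqrt 3)\<^sup>2 * (sin ?r)\<^sup>2)
         + (sgn (weight ?r) * weight'' ?r + cos ?r / sin ?r * (sgn (weight ?r) * weight' ?r)) * (cos ?r / sin ?r)
         - 2 * (sgn (weight ?r) * weight' ?r) / (sin ?r)\<^sup>2
      = sgn (weight ?r) * (weight ?r * (cos ?r / (sin ?r) ^ 3) * (1 - 3 + 2 * 3 * (sin ?r)\<^sup>2)
      + (weight'' ?r + cos ?r / sin ?r * weight' ?r) * (cos ?r / sin ?r)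
      - 2 * weight' ?r / (sin ?r)\<^sup>2)"
      by (simp add: abs_sgn algebra_simps)
    also have "\<dots> = 0"
      using weight_ode[OF I(1-3)[OF MI'[OF x]]] by simp
    finally show ?thesis
      using f_biharmonic_operator[OF open_M M_sub x fM DF1[OF MI'] DF2[OF MI'[OF x]]] by simp
  qed

  \<comment> \<open>At \<open>r = pi / 3\<close> neither the tension nor the bitension vanishes: \<open>cos r\<close> is \<open>1 / 2\<close>, and
    \<open>1 - 3 + 6 * (sin r)\<^sup>2\<close> is \<open>5 / 2\<close>.\<close>
  define p :: "real ^ 2" where "p = vector [pi / 3, 0]"
  have p: "p \<in> M"
  proof -
    have "sqrt 3 * cos (pi / 3) \<noteq> 1" using sqrt3_bounds by (simp add: cos_60)
    then show ?thesis using sqrt3_cos_eq_one_iff[of "pi / 3"] by (simp add: p_def M polar_chart_def)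
  qed
  then have pp: "p \<in> polar_chart" using M_sub by blast
  have "tension sphere_metric sphere_metric \<phi> p \<noteq> 0"
    unfolding tension_eq[OF pp] by (simp add: p_def vec_eq_iff forall_2 cos_60 sin_60)
  then have nh: "\<not> harmonic_map M sphere_metric sphere_metric \<phi>"
    using p by (auto simp: harmonic_map_def)
  have "bitension sphere_metric sphere_metric \<phi> p \<noteq> 0"
    unfolding bitension_eq[OF pp] by (simp add: p_def axis_eq_0_iff cos_60 sin_60 power_divide)
  then have nb: "\<not> biharmonic_map M sphere_metric sphere_metric \<phi>"
    using p by (auto simp: biharmonic_map_def)
  have "riemannian_smooth_map M sphere_metric polar_chart sphere_metric \<phi>"
    unfolding riemannian_smooth_map_def
    using riemannian_metric_sphere[OF open_M M_sub] riemannian_metric_sphere[OF open_polar_chart order_refl]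
      smooth_on_linear[OF bounded_linear_map open_M] map_polar_chart M_sub by auto
  moreover have "f x > 0" if "x \<in> M" for x
    using fM[OF that] I(5)[OF MI'[OF that]] by simp
  ultimately have "proper_f_biharmonic_map M sphere_metric polar_chart sphere_metric f \<phi>"
    unfolding proper_f_biharmonic_map_def f_biharmonic_map_def using smooth_f eq nh nb by blast
  with smooth show ?thesis by blast
qed

end
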